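(* Let $d\ge2$ and let $E_1,\dots,E_d$ be subspaces of $\mathbb{R}^n$ with $\dim E_j=k_j$, $\sum_{j=1}^d k_j=n$, and $\mathbb{R}^n=E_1+\dots+E_d$ as an algebraic direct sum. For each $j$ let $\pi_j$ be the orthogonal projection of $\mathbb{R}^n$ onto $E_j^\perp$ (so that $\ker\pi_j=E_j$). Then for all nonnegative measurable functions $f_j$ on $E_j^\perp$, $$\int_{\mathbb{R}^n}f_1(\pi_1x)^{1/(d-1)}\cdots f_d(\pi_dx)^{1/(d-1)}\,dx\le\left(E_1\wedge\dots\wedge E_d\right)^{-1/(d-1)}\left(\int_{E_1^\perp}f_1\right)^{1/(d-1)}\cdots\left(\int_{E_d^\perp}f_d\right)^{1/(d-1)}.$$
   Context: $E_1\wedge\dots\wedge E_d$ denotes the absolute value of the determinant of the $n\times n$ matrix whose $j$-th block of $k_j$ columns consists of an orthonormal basis of $E_j$; it is independent of the choice of orthonormal bases. Integrals over $E_j^\perp$ are with respect to $(n-k_j)$-dimensional Lebesgue measure. *)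

theory Defs
  imports "HOL-Analysis.Analysis"
begin

definition orthonormal_basis_of :: "'a::euclidean_space set \<Rightarrow> 'a set \<Rightarrow> bool" where
  "orthonormal_basis_of V B \<longleftrightarrow>
     pairwise orthogonal B \<and> (\<forall>b\<in>B. norm b = 1) \<and> span B = V"

definition internal_direct_sum :: "'i set \<Rightarrow> ('i \<Rightarrow> 'a::real_vector set) \<Rightarrow> bool" where
  "internal_direct_sum J E \<longleftrightarrow> (\<forall>x. \<exists>!y. y \<in> (\<Pi>\<^sub>E j\<in>J. E j) \<and> x = (\<Sum>j\<in>J. y j))"

definition orth_proj :: "'a::euclidean_space set \<Rightarrow> 'a \<Rightarrow> 'a" where
  "orth_proj V x = (THE y. y \<in> V \<and> x - y \<in> V\<^sup>\<bottom>)"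

text \<open>
  Lebesgue measure of dimension \<open>dim V\<close> on a subspace \<open>V\<close>, as a measure with space \<open>V\<close>:
  the image of the product Lebesgue measure under orthonormal coordinates. By rotation
  invariance the choice of the orthonormal basis is immaterial. For \<open>V = {0}\<close> it is the
  unit mass at \<open>0\<close>. The completion makes all Lebesgue measurable functions on \<open>V\<close>
  measurable, not only the Borel ones.
\<close>

definition subspace_lborel :: "'a::euclidean_space set \<Rightarrow> 'a measure" where
  "subspace_lborel V =
     (let B = (SOME B. orthonormal_basis_of V B) in
      distr (\<Pi>\<^sub>M b\<in>B. lborel) (restrict_space borel V) (\<lambda>c. \<Sum>b\<in>B. c b *\<^sub>R b))"

definition subspace_lebesgue :: "'a::euclidean_space set \<Rightarrow> 'a measure" where
  "subspace_lebesgue V = completion (subspace_lborel V)"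

text \<open>
  Power of an extended nonnegative number with exponent \<open>p > 0\<close>, with \<open>\<infinity>\<^sup>p = \<infinity>\<close>
  (and \<open>0\<^sup>p = 0\<close>, from \<open>powr\<close>).
\<close>

definition ennreal_powr :: "ennreal \<Rightarrow> real \<Rightarrow> ennreal" where
  "ennreal_powr x p = (if x = \<infinity> then \<infinity> else ennreal (enn2real x powr p))"

text \<open>
  The columns of \<open>A\<close> are distributed into blocks, \<open>\<beta> i\<close> being the block of column \<open>i\<close>,
  and the columns of block \<open>j\<close> are distinct and form an orthonormal basis of \<open>E j\<close>.
  The index type \<open>'n\<close> carries no order, so the blocks need not be consecutive; this affects
  the determinant of \<open>A\<close> at most by a sign.
\<close>

definition block_orthonormal :: "'i set \<Rightarrow> ('i \<Rightarrow> (real^'n) set) \<Rightarrow> real^'n^'n \<Rightarrow> bool" where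
  "block_orthonormal J E A \<longleftrightarrow>
     (\<exists>\<beta>. (\<forall>i. \<beta> i \<in> J) \<and>
          (\<forall>j\<in>J. inj_on (\<lambda>i. column i A) {i. \<beta> i = j} \<and>
                 orthonormal_basis_of (E j) ((\<lambda>i. column i A) ` {i. \<beta> i = j})))"

definition wedge :: "'i set \<Rightarrow> ('i \<Rightarrow> (real^'n) set) \<Rightarrow> real" where
  "wedge J E = \<bar>det (SOME A. block_orthonormal J E A)\<bar>"

lemma orth_proj_eqI:
  assumes "subspace V" "y \<in> V" "x - y \<in> V\<^sup>\<bottom>"
  shows "orth_proj V x = y"
  unfolding orth_proj_def
proof (rule the_equality)
  fix z assume z: "z \<in> V \<and> x - z \<in> V\<^sup>\<bottom>"
  have "z - y \<in> V" using z assms by (simp add: subspace_diff)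
  moreover have "z - y \<in> V\<^sup>\<bottom>"
    using subspace_diff[OF subspace_orthogonal_comp assms(3), of "x - z"] z by simp
  ultimately show "z = y" by (auto simp: orthogonal_comp_def orthogonal_def)
qed (use assms in auto)

lemma orth_proj_properties:
  assumes "subspace V"
  shows "orth_proj V x \<in> V" "x - orth_proj V x \<in> V\<^sup>\<bottom>"
proof -
  obtain y z where yz: "y \<in> span V" "\<And>w. w \<in> span V \<Longrightarrow> orthogonal z w" "x = y + z"
    using orthogonal_subspace_decomp_exists by blast
  have y: "y \<in> V" using yz(1) assms by (metis span_eq_iff)
  moreover have z: "x - y \<in> V\<^sup>\<bottom>"
    using yz by (auto simp: orthogonal_comp_def span_base orthogonal_commute)
  ultimately have "orth_proj V x = y" by (rule orth_proj_eqI[OF assms])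
  then show "orth_proj V x \<in> V" "x - orth_proj V x \<in> V\<^sup>\<bottom>" using y z by auto
qed

lemma orthonormal_basis_of_exists:
  assumes "subspace V"
  shows "\<exists>B. orthonormal_basis_of V B"
  using orthonormal_basis_subspace[OF assms] unfolding orthonormal_basis_of_def by metis

lemma orthonormal_basis_of_expand:
  fixes B :: "'a::euclidean_space set"
  assumes "orthonormal_basis_of V B" "x \<in> V"
  shows "(\<Sum>b\<in>B. (b \<bullet> x) *\<^sub>R b) = x"
proof -
  have B: "pairwise orthogonal B" "\<And>b. b \<in> B \<Longrightarrow> norm b = 1" "span B = V"
    using assms(1) by (auto simp: orthonormal_basis_of_def)
  have "finite B" using pairwise_orthogonal_imp_finite[OF B(1)] .
  have "x - (\<Sum>b\<in>B. (b \<bullet> x / (b \<bullet> b)) *\<^sub>R b) \<in> span B"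
    using assms(2) B(3) by (intro span_diff span_sum span_scale) (auto intro: span_base)
  then have "orthogonal (x - (\<Sum>b\<in>B. (b \<bullet> x / (b \<bullet> b)) *\<^sub>R b))
                        (x - (\<Sum>b\<in>B. (b \<bullet> x / (b \<bullet> b)) *\<^sub>R b))"
    using Gram_Schmidt_step[OF B(1)] orthogonal_commute by blast
  then have "x = (\<Sum>b\<in>B. (b \<bullet> x / (b \<bullet> b)) *\<^sub>R b)" by (simp add: orthogonal_self)
  also have "\<dots> = (\<Sum>b\<in>B. (b \<bullet> x) *\<^sub>R b)"
    using B(2) by (intro sum.cong) (auto simp: dot_square_norm)
  finally show ?thesis by simp
qed

lemma block_orthonormal_abs_det_eq:
  fixes A A' :: "real^'n^'n"
  assumes "block_orthonormal J E A" "block_orthonormal J E A'"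
  shows "\<bar>det A\<bar> = \<bar>det A'\<bar>"
proof -
  obtain \<beta> where \<beta>: "\<And>i. \<beta> i \<in> J"
    "\<And>j. j \<in> J \<Longrightarrow> inj_on (\<lambda>i. column i A) {i. \<beta> i = j}"
    "\<And>j. j \<in> J \<Longrightarrow> orthonormal_basis_of (E j) ((\<lambda>i. column i A) ` {i. \<beta> i = j})"
    using assms(1) unfolding block_orthonormal_def by blast
  obtain \<gamma> where \<gamma>: "\<And>i. \<gamma> i \<in> J"
    "\<And>j. j \<in> J \<Longrightarrow> inj_on (\<lambda>i. column i A') {i. \<gamma> i = j}"
    "\<And>j. j \<in> J \<Longrightarrow> orthonormal_basis_of (E j) ((\<lambda>i. column i A') ` {i. \<gamma> i = j})"
    using assms(2) unfolding block_orthonormal_def by blast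
  define Q :: "real^'n^'n" where
    "Q = (\<chi> i l. if \<beta> i = \<gamma> l then column i A \<bullet> column l A' else 0)"
  have expand: "(\<Sum>i | \<beta> i = j. (column i A \<bullet> x) *\<^sub>R column i A) = x" if "j \<in> J" "x \<in> E j" for j x
    using orthonormal_basis_of_expand[OF \<beta>(3) that(2)] that(1)
    by (simp add: sum.reindex[OF \<beta>(2)])
  have mem: "column l A' \<in> E (\<gamma> l)" for l
  proof -
    have "column l A' \<in> span ((\<lambda>i. column i A') ` {i. \<gamma> i = \<gamma> l})"
      by (rule span_base) auto
    then show ?thesis using \<gamma>(3)[OF \<gamma>(1)[of l]] by (simp add: orthonormal_basis_of_def)
  qed
  have AQ: "A ** Q = A'"
  proof -
    have "(A ** Q) $ r $ l = A' $ r $ l" for r l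
    proof -
      have "A' $ r $ l = column l A' $ r" by (simp add: column_def)
      also have "column l A' = (\<Sum>i | \<beta> i = \<gamma> l. (column i A \<bullet> column l A') *\<^sub>R column i A)"
        using expand[OF \<gamma>(1) mem] by simp
      also have "\<dots> $ r = (\<Sum>i | \<beta> i = \<gamma> l. (column i A \<bullet> column l A') * A $ r $ i)"
        by (simp add: column_def)
      also have "\<dots> = (\<Sum>i\<in>UNIV. if \<beta> i = \<gamma> l then (column i A \<bullet> column l A') * A $ r $ i else 0)"
        by (simp add: sum.If_cases)
      also have "\<dots> = (A ** Q) $ r $ l"
        by (auto simp: matrix_matrix_mult_def Q_def intro!: sum.cong)
      finally show ?thesis by simp
    qed
    then show ?thesis by (simp add: vec_eq_iff)
  qed
  have QQ: "transpose Q ** Q = mat 1"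
  proof -
    have "(transpose Q ** Q) $ l $ m = mat 1 $ l $ m" for l m
    proof (cases "\<gamma> l = \<gamma> m")
      case False
      then have "(transpose Q ** Q) $ l $ m = 0"
        by (auto simp: matrix_matrix_mult_def transpose_def Q_def intro!: sum.neutral)
      then show ?thesis using False by (auto simp: mat_def)
    next
      case True
      have "(transpose Q ** Q) $ l $ m =
          (\<Sum>i\<in>UNIV. if \<beta> i = \<gamma> m then (column i A \<bullet> column l A') * (column i A \<bullet> column m A') else 0)"
        using True by (auto simp: matrix_matrix_mult_def transpose_def Q_def intro!: sum.cong)
      also have "\<dots> = (\<Sum>i | \<beta> i = \<gamma> m. (column i A \<bullet> column l A') * (column i A \<bullet> column m A'))"
        by (simp add: sum.If_cases)
      also have "\<dots> = (\<Sum>i | \<beta> i = \<gamma> m. (column i A \<bullet> column m A') *\<^sub>R column i A) \<bullet> column l A'"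
        by (simp add: inner_sum_left mult.commute)
      also have "\<dots> = column m A' \<bullet> column l A'" using expand[OF \<gamma>(1) mem] by simp
      also have "\<dots> = mat 1 $ l $ m"
      proof -
        let ?C = "(\<lambda>i. column i A') ` {i. \<gamma> i = \<gamma> m}"
        have C: "pairwise orthogonal ?C" "\<forall>c\<in>?C. norm c = 1"
          using \<gamma>(3)[OF \<gamma>(1)[of m]] by (auto simp: orthonormal_basis_of_def)
        show ?thesis
        proof (cases "l = m")
          case True
          then show ?thesis using C(2) by (auto simp: mat_def dot_square_norm)
        next
          case False
          then have "column m A' \<noteq> column l A'"
            using \<gamma>(2)[OF \<gamma>(1)[of m]] \<open>\<gamma> l = \<gamma> m\<close> unfolding inj_on_def by auto
          then have "orthogonal (column m A') (column l A')"
            using C(1) \<open>\<gamma> l = \<gamma> m\<close> by (auto simp: pairwise_def)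
          then show ?thesis using False by (simp add: mat_def orthogonal_def)
        qed
      qed
      finally show ?thesis .
    qed
    then show ?thesis by (simp add: vec_eq_iff)
  qed
  have "orthogonal_matrix Q" using QQ by (simp add: orthogonal_matrix)
  then have "\<bar>det Q\<bar> = 1" using det_orthogonal_matrix by fastforce
  then show ?thesis using AQ by (metis abs_mult det_mul mult.right_neutral)
qed

lemma wedge_eq:
  assumes "block_orthonormal J E A"
  shows "wedge J E = \<bar>det A\<bar>"
  unfolding wedge_def
  by (rule block_orthonormal_abs_det_eq[OF someI[of "block_orthonormal J E", OF assms] assms])

lemma block_orthonormal_exists:
  fixes E :: "'i \<Rightarrow> (real^'n) set"
  assumes "finite J" "\<And>j. j \<in> J \<Longrightarrow> subspace (E j)" "(\<Sum>j\<in>J. dim (E j)) = CARD('n)"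
  shows "\<exists>A. block_orthonormal J E A"
proof -
  have "\<forall>j\<in>J. \<exists>B. orthonormal_basis_of (E j) B"
    using orthonormal_basis_of_exists assms(2) by blast
  from bchoice[OF this] obtain B where B: "\<And>j. j \<in> J \<Longrightarrow> orthonormal_basis_of (E j) (B j)" by blast
  have fin: "finite (B j)" if "j \<in> J" for j
    using B[OF that] pairwise_orthogonal_imp_finite unfolding orthonormal_basis_of_def by blast
  have card: "card (B j) = dim (E j)" if "j \<in> J" for j
  proof -
    have "independent (B j)"
      using B[OF that] unfolding orthonormal_basis_of_def
      by (intro pairwise_orthogonal_independent) auto
    then show ?thesis
      using B[OF that] unfolding orthonormal_basis_of_def by (metis dim_span_eq_card_independent)
  qed
  have "card (Sigma J B) = CARD('n)"
    using assms(1,3) fin card by (simp add: card_SigmaI)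
  moreover have "finite (Sigma J B)" using assms(1) fin by auto
  ultimately obtain h :: "'n \<Rightarrow> 'i \<times> (real^'n)" where h: "bij_betw h UNIV (Sigma J B)"
    using finite_same_card_bij[of "UNIV::'n set" "Sigma J B"] by auto
  define A :: "real^'n^'n" where "A = (\<chi> r i. snd (h i) $ r)"
  have col: "column i A = snd (h i)" for i by (simp add: A_def column_def vec_eq_iff)
  have hm: "h i \<in> Sigma J B" for i using h by (auto simp: bij_betw_def)
  have "inj_on (\<lambda>i. column i A) {i. fst (h i) = j}" for j
    using h unfolding bij_betw_def inj_on_def col by (auto simp: prod_eq_iff)
  moreover have "(\<lambda>i. column i A) ` {i. fst (h i) = j} = B j" if "j \<in> J" for j
  proof
    show "(\<lambda>i. column i A) ` {i. fst (h i) = j} \<subseteq> B j"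
    proof
      fix x assume "x \<in> (\<lambda>i. column i A) ` {i. fst (h i) = j}"
      then obtain i where "x = snd (h i)" "fst (h i) = j" unfolding col by blast
      then show "x \<in> B j" using hm[of i] by (auto simp: mem_Sigma_iff split_beta)
    qed
    show "B j \<subseteq> (\<lambda>i. column i A) ` {i. fst (h i) = j}"
    proof
      fix b assume "b \<in> B j"
      then have "(j, b) \<in> range h" using h that by (auto simp: bij_betw_def)
      then obtain i where "h i = (j, b)" by (metis imageE)
      then show "b \<in> (\<lambda>i. column i A) ` {i. fst (h i) = j}" unfolding col by (intro image_eqI[of _ _ i]) auto
    qed
  qed
  moreover have "fst (h i) \<in> J" for i using hm[of i] by auto
  ultimately show ?thesis
    unfolding block_orthonormal_def using B by (intro exI[of _ A] exI[of _ "\<lambda>i. fst (h i)"]) auto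
qed

end

theory Submission
  imports Defs
begin

text \<open>
  The inequality is a Loomis--Whitney inequality in oblique coordinates. Let \<open>v i\<close> be the
  columns of a matrix \<open>A\<close> whose blocks are orthonormal bases of the \<open>E j\<close>, and write
  \<open>x = (\<Sum>i. c i *\<^sub>R v i)\<close>. Since \<open>\<pi> j\<close> kills exactly the block \<open>j\<close>, the \<open>j\<close>-th factor depends
  only on the coordinates outside block \<open>j\<close>, and each coordinate occurs in all factors but one.
  With the exponents \<open>p = 1 / (d - 1)\<close>, those at each coordinate add up to \<open>1\<close>, which is the
  hypothesis of Finner's inequality (\<open>nn_integral_Finner\<close>), an iterated Hoelder inequality
  over product measures.

  It remains to count Jacobians, and all of them turn out to be \<open>w = \<bar>det A\<bar>\<close>. The change of variables
  \<open>x = A c\<close> contributes \<open>w\<close>. The map from the coordinates outside block \<open>j\<close> to \<open>(E j)\<^sup>\<bottom>\<close>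
  has Jacobian \<open>w\<close> as well (\<open>nn_integral_subspace_lborel_oblique\<close>): subtracting vectors of \<open>E j\<close>
  from the other columns makes them orthogonal to \<open>E j\<close> and does not change the determinant.
  Altogether the constant is \<open>w * (1 / w) powr (d * p) = w powr (- p)\<close>.

  That Jacobian is computed by integration, without any manipulation of determinants of
  projected vectors: for \<open>h\<close> on \<open>(E j)\<^sup>\<bottom>\<close>, the integral over all of the space of \<open>h (\<pi> j x)\<close>, cut off by
  the condition that the \<open>E j\<close>-part of \<open>x\<close> lies in a unit cube, is evaluated in the coordinates given by \<open>v\<close>,
  and again in those of an orthonormal basis adapted to \<open>E j\<close>. In either case translation
  invariance makes the integral over block \<open>j\<close> equal to \<open>1\<close>
  (\<open>nn_integral_orth_proj_unit_cube\<close>).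

  The functions \<open>f j\<close> are Lebesgue, not Borel, measurable. Replacing each by a Borel majorant with the same
  integral (\<open>completion_borel_majorant\<close>) increases the left-hand side and leaves the right-hand side
  unchanged, so that no null sets have to be pulled back along the projections.
\<close>

section \<open>Hoelder and Finner inequalities for extended nonnegative functions\<close>

lemma ennreal_powr_ennreal [simp]: "0 \<le> a \<Longrightarrow> ennreal_powr (ennreal a) p = ennreal (a powr p)"
  by (simp add: ennreal_powr_def)

lemma ennreal_powr_top [simp]: "ennreal_powr top p = top"
  by (simp add: ennreal_powr_def)

lemma ennreal_powr_0 [simp]: "ennreal_powr 0 p = 0"
  by (simp add: ennreal_powr_def)

lemma ennreal_powr_eq_0_iff [simp]: "ennreal_powr x p = 0 \<longleftrightarrow> x = 0"
  by (cases x) (auto simp: ennreal_powr_def)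

lemma ennreal_powr_mono:
  assumes "x \<le> y" "0 \<le> p"
  shows "ennreal_powr x p \<le> ennreal_powr y p"
  using assms by (cases x; cases y) (auto simp: ennreal_powr_def powr_mono2 top_unique)

lemma ennreal_powr_mult:
  "ennreal_powr (x * y) p = ennreal_powr x p * ennreal_powr y p"
proof (cases "x = 0 \<or> y = 0")
  case False
  show ?thesis
  proof (cases "x = \<infinity> \<or> y = \<infinity>")
    case True
    then show ?thesis using False by (auto simp: ennreal_mult_eq_top_iff ennreal_powr_def
       ennreal_top_mult ennreal_mult_top powr_non_neg enn2real_eq_0_iff)
  next
    case False
    then obtain a b where "x = ennreal a" "y = ennreal b" "0 \<le> a" "0 \<le> b" by (cases x; cases y) auto
    then show ?thesis by (simp add: powr_mult flip: ennreal_mult)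
  qed
qed auto

lemma measurable_ennreal_powr [measurable]:
  assumes [measurable]: "f \<in> borel_measurable M"
  shows "(\<lambda>x. ennreal_powr (f x) p) \<in> borel_measurable M"
  unfolding ennreal_powr_def by measurable

text \<open>
  Concavity of the logarithm gives the inequality when all \<open>a j\<close> are positive; otherwise the left-hand
  side vanishes.
\<close>

lemma weighted_arith_geom_mean:
  fixes a p :: "'i \<Rightarrow> real"
  assumes "finite J" "\<And>j. j \<in> J \<Longrightarrow> 0 \<le> a j" "\<And>j. j \<in> J \<Longrightarrow> 0 < p j" "sum p J = 1"
  shows "(\<Prod>j\<in>J. a j powr p j) \<le> (\<Sum>j\<in>J. p j * a j)"
proof (cases "\<exists>j\<in>J. a j = 0")
  case True
  then have "(\<Prod>j\<in>J. a j powr p j) = 0" using assms(1) by (auto intro!: prod_zero)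
  also have "\<dots> \<le> (\<Sum>j\<in>J. p j * a j)"
    using assms by (intro sum_nonneg mult_nonneg_nonneg) (auto simp: less_imp_le)
  finally show ?thesis .
next
  case False
  then have pos: "a j > 0" if "j \<in> J" for j using assms(2)[OF that] that by force
  have ne: "J \<noteq> {}" using assms(4) by auto
  have "(\<Sum>j\<in>J. p j * ln (a j)) \<le> ln (\<Sum>j\<in>J. p j *\<^sub>R a j)"
    by (rule concave_on_sum[OF assms(1) ne ln_concave assms(4)])
       (auto simp: pos assms(3) less_imp_le)
  moreover have "(\<Prod>j\<in>J. a j powr p j) = exp (\<Sum>j\<in>J. p j * ln (a j))"
    using pos assms(1) by (simp add: powr_def exp_sum less_imp_neq[THEN not_sym] cong: prod.cong)
  moreover have "0 < (\<Sum>j\<in>J. p j * a j)"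
    using pos assms ne by (intro sum_pos) auto
  ultimately show ?thesis by (simp add: ln_ge_iff)
qed

lemma weighted_arith_geom_mean_ennreal:
  fixes x :: "'i \<Rightarrow> ennreal"
  assumes "finite J" "\<And>j. j \<in> J \<Longrightarrow> 0 < p j" "sum p J = 1"
  shows "(\<Prod>j\<in>J. ennreal_powr (x j) (p j)) \<le> (\<Sum>j\<in>J. ennreal (p j) * x j)"
proof (cases "\<exists>j\<in>J. x j = \<infinity>")
  case True
  then obtain j where "j \<in> J" "x j = \<infinity>" by blast
  then have "ennreal (p j) * x j = \<infinity>" using assms(2)[of j] by (simp add: ennreal_mult_top)
  then have "(\<Sum>j\<in>J. ennreal (p j) * x j) = \<infinity>"
    using \<open>j \<in> J\<close> assms(1) by auto
  then show ?thesis by simp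
next
  case False
  define a where "a j = enn2real (x j)" for j
  have x: "x j = ennreal (a j)" if "j \<in> J" for j
    using False that by (simp add: a_def ennreal_enn2real_if)
  have a: "0 \<le> a j" for j by (simp add: a_def)
  have "(\<Prod>j\<in>J. ennreal_powr (x j) (p j)) = ennreal (\<Prod>j\<in>J. a j powr p j)"
    using x a by (simp add: prod_ennreal)
  also have "\<dots> \<le> ennreal (\<Sum>j\<in>J. p j * a j)"
    by (rule ennreal_leI[OF weighted_arith_geom_mean]) (use assms a in auto)
  also have "\<dots> = (\<Sum>j\<in>J. ennreal (p j) * x j)"
    using x a assms(2) by (simp add: less_imp_le flip: sum_ennreal ennreal_mult)
  finally show ?thesis .
qed

text \<open>
  Hoelder's inequality for several functions. Normalising the functions to have integral \<open>1\<close> and integrating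
  the weighted arithmetic-geometric mean inequality pointwise bounds the normalised integral by
  the sum of the exponents. Normalising is impossible when an integral is \<open>0\<close> or \<open>\<infinity>\<close>: if one of them is \<open>0\<close>,
  the product vanishes almost everywhere; if one is \<open>\<infinity>\<close> and none is \<open>0\<close>, the bound is infinite.
\<close>

lemma nn_integral_Holder_prod:
  fixes g :: "'i \<Rightarrow> 'a \<Rightarrow> ennreal"
  assumes "finite J" and p: "\<And>j. j \<in> J \<Longrightarrow> 0 < p j" "sum p J = 1"
    and [measurable]: "\<And>j. j \<in> J \<Longrightarrow> g j \<in> borel_measurable M"
  shows "(\<integral>\<^sup>+x. (\<Prod>j\<in>J. ennreal_powr (g j x) (p j)) \<partial>M)
    \<le> (\<Prod>j\<in>J. ennreal_powr (\<integral>\<^sup>+x. g j x \<partial>M) (p j))"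
proof -
  define N where "N j = (\<integral>\<^sup>+x. g j x \<partial>M)" for j
  consider (zero) "\<exists>j\<in>J. N j = 0" | (top) "\<forall>j\<in>J. N j \<noteq> 0" "\<exists>j\<in>J. N j = \<infinity>"
    | (fin) "\<forall>j\<in>J. N j \<noteq> 0" "\<forall>j\<in>J. N j \<noteq> \<infinity>" by blast
  then show ?thesis
  proof cases
    case zero
    then obtain j where j: "j \<in> J" "N j = 0" by blast
    then have "AE x in M. g j x = 0"
      by (simp add: N_def nn_integral_0_iff_AE)
    then have "AE x in M. (\<Prod>j\<in>J. ennreal_powr (g j x) (p j)) = 0"
      by eventually_elim (use j assms(1) in \<open>auto intro!: prod_zero\<close>)
    then have "(\<integral>\<^sup>+x. (\<Prod>j\<in>J. ennreal_powr (g j x) (p j)) \<partial>M) = 0"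
      by (subst nn_integral_0_iff_AE) auto
    then show ?thesis by simp
  next
    case top
    then obtain j where j: "j \<in> J" "N j = \<infinity>" by blast
    have "(\<Prod>i\<in>J. ennreal_powr (N i) (p i)) = \<infinity> * (\<Prod>i\<in>J - {j}. ennreal_powr (N i) (p i))"
      using j assms(1) by (simp add: prod.remove)
    moreover have "(\<Prod>i\<in>J - {j}. ennreal_powr (N i) (p i)) \<noteq> 0"
      using top(1) assms(1) by auto
    ultimately have "(\<Prod>i\<in>J. ennreal_powr (N i) (p i)) = \<infinity>" by (simp add: ennreal_top_mult)
    then show ?thesis by (simp add: N_def)
  next
    case fin
    have split: "g j x = N j * (g j x / N j)" if "j \<in> J" for j x
      using fin that by (metis ennreal_times_divide mult_divide_eq_ennreal mult.commute infinity_ennreal_def)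
    have "(\<integral>\<^sup>+x. (\<Prod>j\<in>J. ennreal_powr (g j x) (p j)) \<partial>M)
        = (\<integral>\<^sup>+x. (\<Prod>j\<in>J. ennreal_powr (N j) (p j)) * (\<Prod>j\<in>J. ennreal_powr (g j x / N j) (p j)) \<partial>M)"
      by (intro nn_integral_cong)
         (simp flip: prod.distrib ennreal_powr_mult split cong: prod.cong)
    also have "\<dots> = (\<Prod>j\<in>J. ennreal_powr (N j) (p j))
          * (\<integral>\<^sup>+x. (\<Prod>j\<in>J. ennreal_powr (g j x / N j) (p j)) \<partial>M)"
      by (rule nn_integral_cmult) measurable
    also have "\<dots> \<le> (\<Prod>j\<in>J. ennreal_powr (N j) (p j)) * (\<integral>\<^sup>+x. (\<Sum>j\<in>J. ennreal (p j) * (g j x / N j)) \<partial>M)"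
      by (intro mult_left_mono nn_integral_mono weighted_arith_geom_mean_ennreal assms) auto
    also have "(\<integral>\<^sup>+x. (\<Sum>j\<in>J. ennreal (p j) * (g j x / N j)) \<partial>M) = (\<Sum>j\<in>J. ennreal (p j) * (N j / N j))"
      by (simp add: nn_integral_sum nn_integral_cmult nn_integral_divide N_def)
    also have "\<dots> = (\<Sum>j\<in>J. ennreal (p j))"
      using fin by (intro sum.cong refl) (simp add: ennreal_divide_self top.not_eq_extremum)
    also have "\<dots> = 1"
      using p by (subst sum_ennreal) (auto simp: less_imp_le)
    finally show ?thesis by (simp add: N_def)
  qed
qed

text \<open>
  Finner's inequality, by induction on the index set of the product. To integrate out one coordinate \<open>i\<close>,
  pull out the factors that do not depend on it and apply Hoelder's inequality to the others; their exponents
  add up to \<open>1\<close>. This replaces each of these \<open>g j\<close> by its integral over the coordinate \<open>i\<close>, and removes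
  \<open>i\<close> from \<open>S j\<close>, so that the exponents at the remaining coordinates are as before.
\<close>

lemma (in product_sigma_finite) nn_integral_Finner:
  fixes S :: "'j \<Rightarrow> 'i set" and g :: "'j \<Rightarrow> ('i \<Rightarrow> 'a) \<Rightarrow> ennreal"
  assumes "finite I" "finite J" and p: "\<And>j. j \<in> J \<Longrightarrow> 0 < p j"
    and S: "\<And>j. j \<in> J \<Longrightarrow> S j \<subseteq> I"
    and cover: "\<And>i. i \<in> I \<Longrightarrow> (\<Sum>j | j \<in> J \<and> i \<in> S j. p j) = 1"
    and g: "\<And>j. j \<in> J \<Longrightarrow> g j \<in> borel_measurable (Pi\<^sub>M (S j) M)"
  shows "(\<integral>\<^sup>+x. (\<Prod>j\<in>J. ennreal_powr (g j (restrict x (S j))) (p j)) \<partial>Pi\<^sub>M I M)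
    \<le> (\<Prod>j\<in>J. ennreal_powr (\<integral>\<^sup>+x. g j x \<partial>Pi\<^sub>M (S j) M) (p j))"
  using \<open>finite I\<close> S cover g
proof (induction I arbitrary: S g)
  case empty
  then have "S j = {}" if "j \<in> J" for j using that by blast
  then show ?case by (simp add: nn_integral_empty restrict_def del: nn_integral_const cong: prod.cong)
next
  case (insert i I)
  note S = insert.prems(1) and cover = insert.prems(2) and g = insert.prems(3)
  define S' where "S' j = S j - {i}" for j
  define g' where "g' j x = (if i \<in> S j then \<integral>\<^sup>+y. g j (x(i := y)) \<partial>M i else g j x)" for j x
  define J1 where "J1 = {j \<in> J. i \<in> S j}"
  define J2 where "J2 = {j \<in> J. i \<notin> S j}"
  have J: "J = J1 \<union> J2" "J1 \<inter> J2 = {}" "finite J1" "finite J2"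
    using assms(2) by (auto simp: J1_def J2_def)
  have S'I: "S' j \<subseteq> I" if "j \<in> J" for j using S[OF that] by (auto simp: S'_def)
  have finS': "finite (S' j)" if "j \<in> J" for j using S'I[OF that] insert.hyps(1) finite_subset by blast
  have ins: "insert i (S' j) = S j" if "j \<in> J1" for j using that by (auto simp: S'_def J1_def)
  have S'2: "S' j = S j" if "j \<in> J2" for j using that by (auto simp: S'_def J2_def)
  have upd [measurable]: "(\<lambda>(x, y). x(i := y)) \<in> Pi\<^sub>M (S' j) M \<Otimes>\<^sub>M M i \<rightarrow>\<^sub>M Pi\<^sub>M (S j) M" if "j \<in> J1" for j
    using measurable_add_dim[of i "S' j" M] ins[OF that] by simp
  have g'_meas: "g' j \<in> borel_measurable (Pi\<^sub>M (S' j) M)" if "j \<in> J" for j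
  proof (cases "j \<in> J1")
    case True
    have [measurable]: "g j \<in> borel_measurable (Pi\<^sub>M (S j) M)" using g[OF that] .
    have "(\<lambda>(x, y). g j (x(i := y))) \<in> borel_measurable (Pi\<^sub>M (S' j) M \<Otimes>\<^sub>M M i)"
      using measurable_compose[OF upd[OF True], of "g j" borel] by (simp add: split_beta')
    then show ?thesis
      using True by (simp add: g'_def[abs_def] J1_def sigma_finite_measure.borel_measurable_nn_integral[OF sigma_finite_measures])
  next
    case False
    then have "i \<notin> S j" "j \<in> J2" using that by (auto simp: J1_def J2_def)
    then show ?thesis using g[OF that] S'2[of j] by (simp add: g'_def[abs_def])
  qed
  have int_g': "(\<integral>\<^sup>+x. g' j x \<partial>Pi\<^sub>M (S' j) M) = (\<integral>\<^sup>+x. g j x \<partial>Pi\<^sub>M (S j) M)" if "j \<in> J" for j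
  proof (cases "j \<in> J1")
    case True
    have "i \<notin> S' j" "i \<in> S j" using True by (auto simp: S'_def J1_def)
    with product_nn_integral_insert[of "S' j" i "g j", unfolded ins[OF True]] finS'[OF that] g[OF that]
    show ?thesis by (simp add: g'_def)
  next
    case False
    then have "i \<notin> S j" "j \<in> J2" using that by (auto simp: J1_def J2_def)
    then show ?thesis using S'2[of j] by (simp add: g'_def)
  qed
  have g'1: "g' j x = (\<integral>\<^sup>+y. g j (x(i := y)) \<partial>M i)" if "j \<in> J1" for j x
    using that by (simp add: g'_def J1_def)
  have g'2: "g' j = g j" if "j \<in> J2" for j
    using that by (simp add: g'_def[abs_def] J2_def)
  have r1: "restrict (x(i := y)) (S j) = (restrict x (S' j))(i := y)" if "j \<in> J1" for x y j
    using that by (auto simp: S'_def J1_def restrict_def)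
  have r2: "restrict (x(i := y)) (S j) = restrict x (S' j)" if "j \<in> J2" for x y j
    using that by (auto simp: S'_def J2_def restrict_def)
  have meas: "(\<lambda>x. \<Prod>j\<in>J. ennreal_powr (g j (restrict x (S j))) (p j)) \<in> borel_measurable (Pi\<^sub>M (insert i I) M)"
    using S g by (intro borel_measurable_prod_ennreal measurable_ennreal_powr
      measurable_compose[OF measurable_restrict_subset]) auto
  have "(\<integral>\<^sup>+x. (\<Prod>j\<in>J. ennreal_powr (g j (restrict x (S j))) (p j)) \<partial>Pi\<^sub>M (insert i I) M)
    = (\<integral>\<^sup>+x. (\<integral>\<^sup>+y. (\<Prod>j\<in>J. ennreal_powr (g j (restrict (x(i := y)) (S j))) (p j)) \<partial>M i) \<partial>Pi\<^sub>M I M)"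
    using insert.hyps meas by (rule product_nn_integral_insert)
  also have "\<dots> \<le> (\<integral>\<^sup>+x. (\<Prod>j\<in>J. ennreal_powr (g' j (restrict x (S' j))) (p j)) \<partial>Pi\<^sub>M I M)"
  proof (rule nn_integral_mono)
    fix x assume x: "x \<in> space (Pi\<^sub>M I M)"
    have gx: "(\<lambda>y. g j ((restrict x (S' j))(i := y))) \<in> borel_measurable (M i)" if "j \<in> J1" for j
    proof -
      have "j \<in> J" using that by (simp add: J1_def)
      have "restrict x (S' j) \<in> space (Pi\<^sub>M (S' j) M)"
        using x S'I[OF \<open>j \<in> J\<close>] by (auto simp: space_PiM)
      then have "(\<lambda>y. (restrict x (S' j))(i := y)) \<in> M i \<rightarrow>\<^sub>M Pi\<^sub>M (S j) M"
        using measurable_component_update[of "restrict x (S' j)" "S' j" M i] ins[OF that]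
        by (simp add: S'_def)
      from measurable_compose[OF this g[OF \<open>j \<in> J\<close>]] show ?thesis .
    qed
    have "(\<integral>\<^sup>+y. (\<Prod>j\<in>J. ennreal_powr (g j (restrict (x(i := y)) (S j))) (p j)) \<partial>M i)
      = (\<integral>\<^sup>+y. (\<Prod>j\<in>J2. ennreal_powr (g' j (restrict x (S' j))) (p j))
          * (\<Prod>j\<in>J1. ennreal_powr (g j ((restrict x (S' j))(i := y))) (p j)) \<partial>M i)"
      unfolding J(1) using J(2-4)
      by (subst prod.union_disjoint) (simp_all add: r1 r2 g'2 mult.commute cong: prod.cong)
    also have "\<dots> = (\<Prod>j\<in>J2. ennreal_powr (g' j (restrict x (S' j))) (p j))
          * (\<integral>\<^sup>+y. (\<Prod>j\<in>J1. ennreal_powr (g j ((restrict x (S' j))(i := y))) (p j)) \<partial>M i)"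
      using gx by (intro nn_integral_cmult borel_measurable_prod_ennreal measurable_ennreal_powr) auto
    also have "\<dots> \<le> (\<Prod>j\<in>J2. ennreal_powr (g' j (restrict x (S' j))) (p j))
          * (\<Prod>j\<in>J1. ennreal_powr (\<integral>\<^sup>+y. g j ((restrict x (S' j))(i := y)) \<partial>M i) (p j))"
      using gx J(3) p cover[of i]
      by (intro mult_left_mono nn_integral_Holder_prod) (auto simp: J1_def)
    also have "\<dots> = (\<Prod>j\<in>J. ennreal_powr (g' j (restrict x (S' j))) (p j))"
      unfolding J(1) using J(2-4)
      by (subst prod.union_disjoint) (simp_all add: g'1 mult.commute cong: prod.cong)
    finally show "(\<integral>\<^sup>+y. (\<Prod>j\<in>J. ennreal_powr (g j (restrict (x(i := y)) (S j))) (p j)) \<partial>M i)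
      \<le> (\<Prod>j\<in>J. ennreal_powr (g' j (restrict x (S' j))) (p j))" .
  qed
  also have "\<dots> \<le> (\<Prod>j\<in>J. ennreal_powr (\<integral>\<^sup>+x. g' j x \<partial>Pi\<^sub>M (S' j) M) (p j))"
  proof (rule insert.IH[OF S'I _ g'_meas])
    fix i' assume "i' \<in> I"
    then have "{j. j \<in> J \<and> i' \<in> S' j} = {j. j \<in> J \<and> i' \<in> S j}"
      using insert.hyps(2) by (auto simp: S'_def)
    then show "(\<Sum>j | j \<in> J \<and> i' \<in> S' j. p j) = 1" using cover[of i'] \<open>i' \<in> I\<close> by simp
  qed
  finally show ?case by (simp only: int_g' cong: prod.cong)
qed

section \<open>Linear change of variables\<close>

abbreviation lborel_PiM :: "'i set \<Rightarrow> ('i \<Rightarrow> real) measure" where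
  "lborel_PiM I \<equiv> \<Pi>\<^sub>M i\<in>I. lborel"

interpretation lborel_PiM: product_sigma_finite "\<lambda>_. lborel :: real measure"
  by standard

text \<open>
  Relabelling of coordinates; it identifies products indexed by a basis with products indexed by the
  columns of a matrix.
\<close>

lemma distr_lborel_PiM_reindex:
  assumes t: "bij_betw t I J" and fin: "finite J"
  shows "distr (lborel_PiM J) (lborel_PiM I) (\<lambda>x. \<lambda>i\<in>I. x (t i)) = lborel_PiM I"
proof (rule lborel_PiM.PiM_eqI)
  show finI: "finite I" using bij_betw_finite[OF t] fin by simp
  have tJ: "t i \<in> J" if "i \<in> I" for i using t that bij_betwE by blast
  fix A assume A: "\<And>i. i \<in> I \<Longrightarrow> A i \<in> sets (lborel :: real measure)"
  let ?s = "the_inv_into I t"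
  have s: "?s j \<in> I" "t (?s j) = j" if "j \<in> J" for j
    using that t by (auto simp: bij_betw_def the_inv_into_into f_the_inv_into_f)
  have st: "?s (t i) = i" if "i \<in> I" for i
    using that t by (simp add: bij_betw_def the_inv_into_f_f)
  have "(\<lambda>x. \<lambda>i\<in>I. x (t i)) -` Pi\<^sub>E I A \<inter> space (lborel_PiM J) = Pi\<^sub>E J (\<lambda>j. A (?s j))"
  proof (intro set_eqI iffI)
    fix x assume "x \<in> (\<lambda>x. \<lambda>i\<in>I. x (t i)) -` Pi\<^sub>E I A \<inter> space (lborel_PiM J)"
    then have x: "\<And>i. i \<in> I \<Longrightarrow> x (t i) \<in> A i" "x \<in> extensional J"
      by (auto simp: space_PiM PiE_def Pi_iff)
    show "x \<in> Pi\<^sub>E J (\<lambda>j. A (?s j))"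
      using x(1)[OF s(1)] x(2) s(2) by (auto simp: PiE_def)
  next
    fix x assume x: "x \<in> Pi\<^sub>E J (\<lambda>j. A (?s j))"
    then have "x (t i) \<in> A i" if "i \<in> I" for i using tJ[OF that] st[OF that] by (auto dest: PiE_mem)
    then show "x \<in> (\<lambda>x. \<lambda>i\<in>I. x (t i)) -` Pi\<^sub>E I A \<inter> space (lborel_PiM J)"
      using x by (auto simp: space_PiM PiE_def)
  qed
  then have "emeasure (distr (lborel_PiM J) (lborel_PiM I) (\<lambda>x. \<lambda>i\<in>I. x (t i))) (Pi\<^sub>E I A)
      = emeasure (lborel_PiM J) (Pi\<^sub>E J (\<lambda>j. A (?s j)))"
    using A finI tJ by (subst emeasure_distr) (auto intro!: sets_PiM_I_finite measurable_restrict)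
  also have "\<dots> = (\<Prod>j\<in>J. emeasure lborel (A (?s j)))"
    using A s fin by (intro lborel_PiM.emeasure_PiM) auto
  also have "\<dots> = (\<Prod>i\<in>I. emeasure lborel (A i))"
    using prod.reindex_bij_betw[OF t, of "\<lambda>j. emeasure lborel (A (?s j))"] st by simp
  finally show "emeasure (distr (lborel_PiM J) (lborel_PiM I) (\<lambda>x. \<lambda>i\<in>I. x (t i))) (Pi\<^sub>E I A)
      = (\<Prod>i\<in>I. emeasure lborel (A i))" .
qed simp

lemma nn_integral_lborel_PiM_reindex:
  assumes t: "bij_betw t I J" and fin: "finite J" and F: "F \<in> borel_measurable (lborel_PiM I)"
  shows "(\<integral>\<^sup>+x. F (\<lambda>i\<in>I. x (t i)) \<partial>lborel_PiM J) = (\<integral>\<^sup>+x. F x \<partial>lborel_PiM I)"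
proof -
  have "(\<lambda>x. \<lambda>i\<in>I. x (t i)) \<in> lborel_PiM J \<rightarrow>\<^sub>M lborel_PiM I"
    using bij_betwE[OF t] by (intro measurable_restrict measurable_component_singleton) auto
  from nn_integral_distr[OF this, of F] F show ?thesis
    by (simp add: distr_lborel_PiM_reindex[OF t fin])
qed

lemma nn_integral_lborel_cart:
  fixes F :: "real^'n \<Rightarrow> ennreal"
  assumes [measurable]: "F \<in> borel_measurable borel"
  shows "(\<integral>\<^sup>+x. F x \<partial>lborel) = (\<integral>\<^sup>+c. F (\<Sum>i\<in>UNIV. c i *\<^sub>R axis i 1) \<partial>lborel_PiM UNIV)"
proof -
  have bij: "bij_betw (\<lambda>i::'n. axis i (1::real)) UNIV Basis"
    by (auto simp: bij_betw_def inj_on_def axis_eq_axis Basis_vec_def)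
  have "(\<integral>\<^sup>+x. F x \<partial>lborel) = (\<integral>\<^sup>+c. F (\<Sum>b\<in>Basis. c b *\<^sub>R b) \<partial>lborel_PiM Basis)"
    by (subst lborel_eq) (simp add: nn_integral_distr)
  also have "\<dots> = (\<integral>\<^sup>+c. F (\<Sum>i\<in>UNIV. c (axis i (1::real)) *\<^sub>R axis i 1) \<partial>lborel_PiM Basis)"
    by (simp add: sum.reindex_bij_betw[OF bij, symmetric])
  also have "\<dots> = (\<integral>\<^sup>+c. F (\<Sum>i\<in>UNIV. c i *\<^sub>R axis i 1) \<partial>lborel_PiM UNIV)"
    using nn_integral_lborel_PiM_reindex[OF bij, of "\<lambda>c. F (\<Sum>i\<in>UNIV. c i *\<^sub>R axis i 1)"] by simp
  finally show ?thesis .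
qed

lemma sum_axis_eq: "(\<Sum>i\<in>UNIV. c i *\<^sub>R axis i (1::real)) = (\<chi> i. c i)"
  by (simp add: vec_eq_iff axis_def if_distrib sum.delta cong: if_cong)

lemma borel_measurable_matrix_vector_mult [measurable]:
  "(*v) (A :: real^'n^'m) \<in> borel_measurable borel"
  by (intro borel_measurable_continuous_onI linear_continuous_on) (simp add: matrix_vector_mul_bounded_linear)

lemma borel_measurable_vec_lambda [measurable]:
  fixes f :: "'n::finite \<Rightarrow> 'a \<Rightarrow> real"
  assumes "\<And>i. f i \<in> borel_measurable M"
  shows "(\<lambda>x. \<chi> i. f i x) \<in> borel_measurable M"
proof -
  have "(\<lambda>x. \<Sum>i\<in>UNIV. f i x *\<^sub>R axis i (1::real)) \<in> borel_measurable M"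
    using assms by measurable
  then show ?thesis by (simp only: sum_axis_eq)
qed

lemma nn_integral_swap:
  fixes F :: "real^'n \<Rightarrow> ennreal"
  assumes [measurable]: "F \<in> borel_measurable borel"
  shows "(\<integral>\<^sup>+x. F (\<chi> i. x $ Transposition.transpose m n i) \<partial>lborel) = (\<integral>\<^sup>+x. F x \<partial>lborel)"
proof -
  have b: "bij_betw (Transposition.transpose m n) UNIV UNIV" by simp
  have "(\<integral>\<^sup>+x. F (\<chi> i. x $ Transposition.transpose m n i) \<partial>lborel)
      = (\<integral>\<^sup>+c. F (\<chi> i. c (Transposition.transpose m n i)) \<partial>lborel_PiM UNIV)"
    by (subst nn_integral_lborel_cart) (simp_all add: sum_axis_eq)
  also have "\<dots> = (\<integral>\<^sup>+c. F (\<chi> i. c i) \<partial>lborel_PiM UNIV)"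
    using nn_integral_lborel_PiM_reindex[OF b, of "\<lambda>c. F (\<chi> i. c i)"] by simp
  also have "\<dots> = (\<integral>\<^sup>+x. F x \<partial>lborel)"
    by (simp add: nn_integral_lborel_cart sum_axis_eq)
  finally show ?thesis .
qed

lemma nn_integral_lborel_translate:
  fixes F :: "real \<Rightarrow> ennreal"
  assumes "F \<in> borel_measurable borel"
  shows "(\<integral>\<^sup>+x. F (t + x) \<partial>lborel) = (\<integral>\<^sup>+x. F x \<partial>lborel)"
  using nn_integral_real_affine[OF assms, of 1 t] by simp

text \<open>
  A shear translates the coordinate \<open>m\<close> by an amount that depends on the other coordinates only; so the claim
  is translation invariance in the coordinate \<open>m\<close>, which is integrated first.
\<close>

lemma nn_integral_shear:
  fixes F :: "real^'n \<Rightarrow> ennreal"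
  assumes [measurable]: "F \<in> borel_measurable borel" and "m \<noteq> n"
  shows "(\<integral>\<^sup>+x. F (\<chi> i. if i = m then x $ m + a * x $ n else x $ i) \<partial>lborel) = (\<integral>\<^sup>+x. F x \<partial>lborel)"
proof -
  have ins: "UNIV = insert m (- {m})" by auto
  have split: "(\<integral>\<^sup>+c. G c \<partial>lborel_PiM UNIV) = (\<integral>\<^sup>+c. (\<integral>\<^sup>+y. G (c(m := y)) \<partial>lborel) \<partial>lborel_PiM (- {m}))"
    if "G \<in> borel_measurable (lborel_PiM UNIV)" for G
    using that lborel_PiM.product_nn_integral_insert[of "- {m}" m G] by (simp flip: ins)
  have "(\<integral>\<^sup>+x. F (\<chi> i. if i = m then x $ m + a * x $ n else x $ i) \<partial>lborel)
      = (\<integral>\<^sup>+c. F (\<chi> i. if i = m then c m + a * c n else c i) \<partial>lborel_PiM UNIV)"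
    by (subst nn_integral_lborel_cart) (simp_all add: sum_axis_eq cong: if_cong)
  also have "\<dots> = (\<integral>\<^sup>+c. (\<integral>\<^sup>+y. F (\<chi> i. if i = m then a * c n + y else c i) \<partial>lborel) \<partial>lborel_PiM (- {m}))"
    using \<open>m \<noteq> n\<close>
    by (subst split) (auto simp: add.commute fun_eq_iff intro!: nn_integral_cong arg_cong[of _ _ F] arg_cong[of _ _ vec_lambda])
  also have "\<dots> = (\<integral>\<^sup>+c. (\<integral>\<^sup>+y. F (\<chi> i. if i = m then y else c i) \<partial>lborel) \<partial>lborel_PiM (- {m}))"
  proof (rule nn_integral_cong)
    fix c :: "'n \<Rightarrow> real"
    show "(\<integral>\<^sup>+y. F (\<chi> i. if i = m then a * c n + y else c i) \<partial>lborel)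
        = (\<integral>\<^sup>+y. F (\<chi> i. if i = m then y else c i) \<partial>lborel)"
      by (rule nn_integral_lborel_translate) measurable
  qed
  also have "\<dots> = (\<integral>\<^sup>+c. F (\<chi> i. c i) \<partial>lborel_PiM UNIV)"
    by (subst split) (auto simp: fun_eq_iff intro!: nn_integral_cong arg_cong[of _ _ F] arg_cong[of _ _ vec_lambda])
  also have "\<dots> = (\<integral>\<^sup>+x. F x \<partial>lborel)"
    by (simp add: nn_integral_lborel_cart sum_axis_eq)
  finally show ?thesis .
qed

lemma nn_integral_stretch:
  fixes F :: "real^'n \<Rightarrow> ennreal"
  assumes [measurable]: "F \<in> borel_measurable borel" and nz: "\<And>i. s i \<noteq> 0"
  shows "(\<integral>\<^sup>+x. F x \<partial>lborel) = ennreal \<bar>prod s UNIV\<bar> * (\<integral>\<^sup>+x. F (\<chi> i. s i * x $ i) \<partial>lborel)"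
proof -
  have bij: "bij_betw (\<lambda>i::'n. axis i (1::real)) UNIV Basis"
    by (auto simp: bij_betw_def inj_on_def axis_eq_axis Basis_vec_def)
  define c where "c b = s (inv_into UNIV (\<lambda>i::'n. axis i (1::real)) b)" for b
  have c: "c (axis i 1) = s i" for i
    using bij_betw_inv_into_left[OF bij, of i] by (simp add: c_def)
  have "(\<Sum>b\<in>Basis. (c b * (x \<bullet> b)) *\<^sub>R b) = (\<chi> i. s i * x $ i)" for x :: "real^'n"
    by (simp add: sum.reindex_bij_betw[OF bij, symmetric] c inner_axis sum_axis_eq)
  moreover have "(\<Prod>b\<in>Basis. \<bar>c b\<bar>) = \<bar>prod s UNIV\<bar>"
    by (simp add: prod.reindex_bij_betw[OF bij, symmetric] c abs_prod)
  moreover have "c b \<noteq> 0" for b using nz by (simp add: c_def)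
  ultimately have *: "(lborel :: (real^'n) measure) =
      density (distr lborel borel (\<lambda>x. \<chi> i. s i * x $ i)) (\<lambda>_. ennreal \<bar>prod s UNIV\<bar>)"
    using lborel_affine_euclidean[where c=c and t="0::real^'n"] by (simp del: abs_prod)
  show ?thesis
    by (subst *) (simp add: nn_integral_density nn_integral_distr nn_integral_cmult)
qed

text \<open>
  Every matrix is a product of diagonal matrices, transpositions, shears and matrices with a zero row,
  and the formula is multiplicative in the matrix.
\<close>

lemma nn_integral_lborel_linear:
  fixes A :: "real^'n^'n" and F :: "real^'n \<Rightarrow> ennreal"
  assumes "det A \<noteq> 0" and "F \<in> borel_measurable borel"
  shows "(\<integral>\<^sup>+x. F x \<partial>lborel) = ennreal \<bar>det A\<bar> * (\<integral>\<^sup>+x. F (A *v x) \<partial>lborel)"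
  using assms
proof (induction A arbitrary: F rule: induct_matrix_elementary)
  case (1 A B)
  note [measurable] = "1.prems"(2)
  have "det A \<noteq> 0" "det B \<noteq> 0" using "1.prems" by (auto simp: det_mul)
  have "(\<integral>\<^sup>+x. F x \<partial>lborel) = ennreal \<bar>det A\<bar> * (ennreal \<bar>det B\<bar> * (\<integral>\<^sup>+x. F (A *v (B *v x)) \<partial>lborel))"
    using \<open>det A \<noteq> 0\<close> \<open>det B \<noteq> 0\<close> by (simp add: "1.IH"(1)[of F] "1.IH"(2)[of "\<lambda>x. F (A *v x)"])
  then show ?case
    by (simp add: det_mul abs_mult ennreal_mult matrix_vector_mul_assoc mult.assoc)
next
  case (2 A i)
  then show ?case using det_zero_row(2) by (metis)
next
  case (3 A)
  have det: "det A = (\<Prod>i\<in>UNIV. A $ i $ i)" using 3 by (intro det_diagonal) auto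
  have "A *v x = (\<chi> i. A $ i $ i * x $ i)" for x
  proof -
    have "(\<Sum>j\<in>UNIV. A $ i $ j * x $ j) = (\<Sum>j\<in>{i}. A $ i $ j * x $ j)" for i
      using 3(1) by (intro sum.mono_neutral_right) auto
    then show ?thesis by (simp add: matrix_vector_mult_def)
  qed
  moreover have "A $ i $ i \<noteq> 0" for i using 3(2) det by simp
  ultimately show ?case using nn_integral_stretch[OF 3(3), of "\<lambda>i. A $ i $ i"] det by simp
next
  case (4 m n)
  let ?A = "\<chi> i j. mat 1 $ i $ Transposition.transpose m n j :: real^'n^'n"
  have "det ?A = - 1"
    using det_permute_columns[of "Transposition.transpose m n" "mat 1 :: real^'n^'n"] 4(1)
    by (simp add: permutes_swap_id sign_swap_id)
  moreover have "?A *v x = (\<chi> i. x $ Transposition.transpose m n i)" for x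
  proof -
    have "mat 1 $ i $ Transposition.transpose m n j * x $ j
        = (if j = Transposition.transpose m n i then x $ j else 0)" for i j
      by (auto simp: mat_def)
    then show ?thesis by (simp add: matrix_vector_mult_def)
  qed
  ultimately show ?case using 4 by (simp add: nn_integral_swap)
next
  case (5 m n c)
  let ?A = "\<chi> i j. if i = m \<and> j = n then c else of_bool (i = j) :: real^'n^'n"
  have "?A = (\<chi> k. if k = m then row m (mat 1) + c *s row n (mat 1) else row k (mat 1))"
    using 5(1) by (auto simp: vec_eq_iff row_def mat_def)
  then have "det ?A = 1" using det_row_operation[OF 5(1), of "mat 1" c] by simp
  moreover have "?A *v x = (\<chi> i. if i = m then x $ m + c * x $ n else x $ i)" for x
  proof -
    have "(if i = m \<and> j = n then c else of_bool (i = j)) * x $ j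
        = (if j = i then x $ j else 0) + (if j = n then (if i = m then c * x $ j else 0) else 0)" for i j
      using 5(1) by auto
    then show ?thesis by (simp add: matrix_vector_mult_def vec_eq_iff sum.distrib)
  qed
  ultimately show ?case using 5 by (simp add: nn_integral_shear)
qed

lemma nn_integral_lborel_columns:
  fixes v :: "'n \<Rightarrow> real^'n" and F :: "real^'n \<Rightarrow> ennreal"
  assumes "det (\<chi> r i. v i $ r) \<noteq> 0" and [measurable]: "F \<in> borel_measurable borel"
  shows "(\<integral>\<^sup>+x. F x \<partial>lborel)
    = ennreal \<bar>det (\<chi> r i. v i $ r)\<bar> * (\<integral>\<^sup>+c. F (\<Sum>i\<in>UNIV. c i *\<^sub>R v i) \<partial>lborel_PiM UNIV)"
proof -
  have "(\<chi> r i. v i $ r) *v (\<chi> i. c i) = (\<Sum>i\<in>UNIV. c i *\<^sub>R v i)" for c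
    by (simp add: vec_eq_iff matrix_vector_mult_def mult.commute)
  then show ?thesis
    using nn_integral_lborel_cart[of "\<lambda>x. F ((\<chi> r i. v i $ r) *v x)"]
    by (simp add: nn_integral_lborel_linear[OF assms] sum_axis_eq)
qed

section \<open>Integration over orthogonal complements\<close>

lemma orth_proj_ident: "subspace V \<Longrightarrow> x \<in> V \<Longrightarrow> orth_proj V x = x"
  by (rule orth_proj_eqI) (auto simp: orthogonal_comp_def orthogonal_def)

lemma orth_proj_orthogonal_comp: "subspace V \<Longrightarrow> x \<in> V\<^sup>\<bottom> \<Longrightarrow> orth_proj V x = 0"
  by (rule orth_proj_eqI) (auto simp: subspace_0)

lemma linear_orth_proj:
  assumes V: "subspace V"
  shows "linear (orth_proj V)"
proof (rule linearI)
  fix x y :: 'a and c :: real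
  have "(x - orth_proj V x) + (y - orth_proj V y) \<in> V\<^sup>\<bottom>"
    using orth_proj_properties[OF V] by (intro subspace_add subspace_orthogonal_comp)
  then show "orth_proj V (x + y) = orth_proj V x + orth_proj V y"
    by (intro orth_proj_eqI[OF V] subspace_add[OF V] orth_proj_properties[OF V]) (simp add: algebra_simps)
  have "c *\<^sub>R (x - orth_proj V x) \<in> V\<^sup>\<bottom>"
    using orth_proj_properties[OF V] by (intro subspace_scale subspace_orthogonal_comp)
  then show "orth_proj V (c *\<^sub>R x) = c *\<^sub>R orth_proj V x"
    by (intro orth_proj_eqI[OF V] subspace_scale[OF V] orth_proj_properties[OF V]) (simp add: algebra_simps)
qed

lemma measurable_orth_proj:
  assumes "subspace V"
  shows "orth_proj V \<in> borel \<rightarrow>\<^sub>M restrict_space borel V"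
  using linear_orth_proj[OF assms] orth_proj_properties(1)[OF assms]
  by (intro measurable_restrict_space2 borel_measurable_continuous_onI linear_continuous_on
      linear_linear[THEN iffD1]) (auto simp: linear_conv_bounded_linear)

lemma sets_subspace_lborel: "sets (subspace_lborel V) = sets (restrict_space borel V)"
  by (simp add: subspace_lborel_def Let_def)

text \<open>
  The orthonormal basis \<open>B\<close> chosen in the definition of the measure, with its vectors
  labelled by an arbitrary index set, gives the coordinates in which integrals over \<open>V\<close> are computed below.
\<close>

lemma nn_integral_subspace_lborel:
  fixes V :: "'a::euclidean_space set"
  assumes V: "subspace V" and h: "h \<in> borel_measurable (restrict_space borel V)"
  obtains B where "orthonormal_basis_of V B"
    "\<And>(b :: 'i \<Rightarrow> 'a) I. bij_betw b I B \<Longrightarrow>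
      (\<integral>\<^sup>+y. h y \<partial>subspace_lborel V) = (\<integral>\<^sup>+c. h (\<Sum>i\<in>I. c i *\<^sub>R b i) \<partial>lborel_PiM I)"
proof -
  define B where "B = (SOME B. orthonormal_basis_of V B)"
  have B: "orthonormal_basis_of V B"
    unfolding B_def by (rule someI_ex[OF orthonormal_basis_of_exists[OF V]])
  have BV: "B \<subseteq> V" and finB: "finite B"
    using B pairwise_orthogonal_imp_finite span_superset by (auto simp: orthonormal_basis_of_def)
  have comb: "(\<lambda>c. \<Sum>i\<in>I. c i *\<^sub>R b i) \<in> lborel_PiM I \<rightarrow>\<^sub>M restrict_space borel V" if "b ` I \<subseteq> B" for b and I :: "'k set"
    using that BV by (intro measurable_restrict_space2) (auto intro!: subspace_sum[OF V] subspace_scale[OF V])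
  have "(\<integral>\<^sup>+y. h y \<partial>subspace_lborel V) = (\<integral>\<^sup>+c. h (\<Sum>i\<in>I. c i *\<^sub>R b i) \<partial>lborel_PiM I)"
    if b: "bij_betw b I B" for b :: "'i \<Rightarrow> 'a" and I
  proof -
    have "(\<integral>\<^sup>+y. h y \<partial>subspace_lborel V) = (\<integral>\<^sup>+c. h (\<Sum>b\<in>B. c b *\<^sub>R b) \<partial>lborel_PiM B)"
      using comb[of id B] h by (simp add: subspace_lborel_def flip: B_def) (simp add: nn_integral_distr)
    also have "\<dots> = (\<integral>\<^sup>+c. h (\<Sum>i\<in>I. c (b i) *\<^sub>R b i) \<partial>lborel_PiM B)"
      by (simp add: sum.reindex_bij_betw[OF b, symmetric])
    also have "\<dots> = (\<integral>\<^sup>+c. h (\<Sum>i\<in>I. c i *\<^sub>R b i) \<partial>lborel_PiM I)"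
    proof -
      have "(\<lambda>c. h (\<Sum>i\<in>I. c i *\<^sub>R b i)) \<in> borel_measurable (lborel_PiM I)"
        using b by (intro measurable_compose[OF comb h]) (simp add: bij_betw_def)
      from nn_integral_lborel_PiM_reindex[OF b finB this] show ?thesis by simp
    qed
    finally show ?thesis .
  qed
  with B show ?thesis using that by blast
qed

text \<open>
  In the coordinates given by \<open>v\<close>, the point \<open>x\<close> is the sum of a part with coefficients outside \<open>K\<close> and a part in
  \<open>V\<^sup>\<bottom>\<close> with coefficients in \<open>K\<close>. The factor \<open>h\<close> sees the first part only. For a fixed first part, the
  other factor restricts the coefficients in \<open>K\<close> to a translate of the unit cube, hence integrates to \<open>1\<close>.
  Apart from the vectors \<open>v i\<close> with \<open>i \<in> K\<close>, the left-hand side does not depend on \<open>v\<close>; comparing two choices of the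
  remaining vectors is the purpose of the lemma.
\<close>

lemma nn_integral_orth_proj_unit_cube:
  fixes v :: "'n \<Rightarrow> real^'n" and h :: "real^'n \<Rightarrow> ennreal"
  assumes V: "subspace V" and h: "h \<in> borel_measurable (restrict_space borel V)"
    and vK: "\<And>i. i \<in> K \<Longrightarrow> v i \<in> V\<^sup>\<bottom>"
    and ortho: "\<And>i l. i \<in> K \<Longrightarrow> l \<in> K \<Longrightarrow> v i \<bullet> v l = of_bool (i = l)"
    and det: "det (\<chi> r i. v i $ r) \<noteq> 0"
  shows "(\<integral>\<^sup>+x. h (orth_proj V x) * (\<Prod>l\<in>K. indicator {0..1} (x \<bullet> v l)) \<partial>lborel)
    = ennreal \<bar>det (\<chi> r i. v i $ r)\<bar>
      * (\<integral>\<^sup>+c. h (\<Sum>i\<in>-K. c i *\<^sub>R orth_proj V (v i)) \<partial>lborel_PiM (-K))"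
proof -
  define F where "F x = h (orth_proj V x) * (\<Prod>l\<in>K. indicator {0..1} (x \<bullet> v l))" for x
  have [measurable]: "(\<lambda>x. h (orth_proj V x)) \<in> borel_measurable borel"
    using measurable_compose[OF measurable_orth_proj[OF V] h] .
  have F [measurable]: "F \<in> borel_measurable borel" unfolding F_def by measurable
  have lin: "linear (orth_proj V)" using linear_orth_proj[OF V] .
  have sum_merge: "(\<Sum>i\<in>UNIV. merge (-K) K (x, y) i *\<^sub>R v i)
      = (\<Sum>i\<in>-K. x i *\<^sub>R v i) + (\<Sum>i\<in>K. y i *\<^sub>R v i)" for x y
  proof -
    have "(\<Sum>i\<in>UNIV. merge (-K) K (x, y) i *\<^sub>R v i)
      = (\<Sum>i\<in>-K. merge (-K) K (x, y) i *\<^sub>R v i) + (\<Sum>i\<in>K. merge (-K) K (x, y) i *\<^sub>R v i)"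
      by (subst sum.union_disjoint[symmetric]) (auto simp: Un_commute)
    also have "\<dots> = (\<Sum>i\<in>-K. x i *\<^sub>R v i) + (\<Sum>i\<in>K. y i *\<^sub>R v i)"
      by (intro arg_cong2[where f = "(+)"] sum.cong) (auto simp: merge_def)
    finally show ?thesis .
  qed
  have F_merge: "F ((\<Sum>i\<in>-K. x i *\<^sub>R v i) + (\<Sum>i\<in>K. y i *\<^sub>R v i))
      = h (\<Sum>i\<in>-K. x i *\<^sub>R orth_proj V (v i))
        * (\<Prod>l\<in>K. indicator {0..1} ((\<Sum>i\<in>-K. x i *\<^sub>R v i) \<bullet> v l + y l))" for x y
  proof -
    have "orth_proj V ((\<Sum>i\<in>-K. x i *\<^sub>R v i) + (\<Sum>i\<in>K. y i *\<^sub>R v i))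
        = (\<Sum>i\<in>-K. x i *\<^sub>R orth_proj V (v i))"
      using orth_proj_orthogonal_comp[OF V vK]
      by (simp add: linear_add[OF lin] linear_sum[OF lin] linear_scale[OF lin])
    moreover have "(\<Sum>i\<in>K. y i *\<^sub>R v i) \<bullet> v l = y l" if "l \<in> K" for l
      using that by (simp add: inner_sum_left ortho sum.delta of_bool_def if_distrib cong: if_cong)
    ultimately show ?thesis by (simp add: F_def inner_add_left cong: prod.cong)
  qed
  have cube: "(\<integral>\<^sup>+y. (\<Prod>l\<in>K. indicator {0..1} (w l + y l)) \<partial>lborel_PiM K) = (1::ennreal)" for w :: "'n \<Rightarrow> real"
  proof -
    have "(\<integral>\<^sup>+y. indicator {0..1} (a + y) \<partial>lborel) = (1::ennreal)" for a :: real
      using nn_integral_lborel_translate[of "indicator {0..1}" a] by simp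
    then show ?thesis
      by (subst lborel_PiM.product_nn_integral_prod[where f = "\<lambda>l y. indicator {0..1} (w l + y)"]) simp_all
  qed
  have "(\<integral>\<^sup>+c. F (\<Sum>i\<in>UNIV. c i *\<^sub>R v i) \<partial>lborel_PiM UNIV)
      = (\<integral>\<^sup>+x. (\<integral>\<^sup>+y. F (\<Sum>i\<in>UNIV. merge (-K) K (x, y) i *\<^sub>R v i) \<partial>lborel_PiM K) \<partial>lborel_PiM (-K))"
    using lborel_PiM.product_nn_integral_fold[of "-K" K "\<lambda>c. F (\<Sum>i\<in>UNIV. c i *\<^sub>R v i)"]
    by (simp add: Un_commute[of "- K"])
  also have "\<dots> = (\<integral>\<^sup>+x. h (\<Sum>i\<in>-K. x i *\<^sub>R orth_proj V (v i)) \<partial>lborel_PiM (-K))"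
    by (simp add: sum_merge F_merge nn_integral_cmult cube)
  finally show ?thesis
    using nn_integral_lborel_columns[OF det F] by (simp add: F_def)
qed

lemma abs_det_orthonormal_columns:
  fixes v :: "'n \<Rightarrow> real^'n"
  assumes "\<And>i l. v i \<bullet> v l = of_bool (i = l)"
  shows "\<bar>det (\<chi> r i. v i $ r)\<bar> = 1"
proof -
  have "transpose (\<chi> r i. v i $ r) ** (\<chi> r i. v i $ r) = mat 1"
    using assms by (simp add: vec_eq_iff matrix_matrix_mult_def transpose_def mat_def inner_vec_def)
  then have "orthogonal_matrix (\<chi> r i. v i $ r)" by (simp add: orthogonal_matrix)
  then show ?thesis using det_orthogonal_matrix by fastforce
qed

text \<open>
  The unit cube in \<open>E\<close> spanned by the \<open>v i\<close> with \<open>i \<in> K\<close> is the same for the given family \<open>v\<close> and for the family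
  \<open>w\<close> that continues these vectors by an orthonormal basis of \<open>E\<^sup>\<bottom>\<close>. Applying \<open>nn_integral_orth_proj_unit_cube\<close> to both
  expresses one integral in two ways: for \<open>w\<close> the determinant is \<open>1\<close> in absolute value and the projections
  are trivial, which leaves the integral over \<open>E\<^sup>\<bottom>\<close>.
\<close>

lemma nn_integral_subspace_lborel_oblique:
  fixes v :: "'n \<Rightarrow> real^'n" and h :: "real^'n \<Rightarrow> ennreal"
  assumes inj: "inj_on v K" and E: "orthonormal_basis_of E (v ` K)"
    and h: "h \<in> borel_measurable (restrict_space borel (E\<^sup>\<bottom>))"
    and det: "det (\<chi> r i. v i $ r) \<noteq> 0"
  shows "(\<integral>\<^sup>+y. h y \<partial>subspace_lborel (E\<^sup>\<bottom>))
    = ennreal \<bar>det (\<chi> r i. v i $ r)\<bar>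
      * (\<integral>\<^sup>+c. h (\<Sum>i\<in>-K. c i *\<^sub>R orth_proj (E\<^sup>\<bottom>) (v i)) \<partial>lborel_PiM (-K))"
proof -
  have V: "subspace (E\<^sup>\<bottom>)" by (rule subspace_orthogonal_comp)
  have sE: "subspace E" using E by (auto simp: orthonormal_basis_of_def)
  obtain B where B: "orthonormal_basis_of (E\<^sup>\<bottom>) B"
    and int: "\<And>(b :: 'n \<Rightarrow> real^'n) I. bij_betw b I B \<Longrightarrow>
      (\<integral>\<^sup>+y. h y \<partial>subspace_lborel (E\<^sup>\<bottom>)) = (\<integral>\<^sup>+c. h (\<Sum>i\<in>I. c i *\<^sub>R b i) \<partial>lborel_PiM I)"
    by (rule nn_integral_subspace_lborel[OF V h]) (rule that)
  have finB: "finite B" using B pairwise_orthogonal_imp_finite by (auto simp: orthonormal_basis_of_def)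
  have card_basis: "card C = dim W" if "orthonormal_basis_of W C" for W and C :: "(real^'n) set"
  proof -
    have "independent C" using that unfolding orthonormal_basis_of_def
      by (intro pairwise_orthogonal_independent) auto
    then show ?thesis using that unfolding orthonormal_basis_of_def by (metis dim_span_eq_card_independent)
  qed
  have "dim E + dim (E\<^sup>\<bottom>) = CARD('n)"
    using dim_subspace_orthogonal_to_vectors[of E UNIV] sE
    by (simp add: orthogonal_comp_def orthogonal_commute)
  moreover have "card K = dim E" using card_basis[OF E] by (simp add: card_image[OF inj])
  ultimately have "card (-K) = card B" using card_basis[OF B] card_Diff_subset[of K UNIV] by (simp add: Compl_eq_Diff_UNIV)
  then obtain b where b: "bij_betw b (-K) B"
    using finite_same_card_bij[of "-K" B] finB by auto
  define w where "w i = (if i \<in> K then v i else b i)" for i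
  have bB: "b i \<in> B" if "i \<notin> K" for i using b that by (auto simp: bij_betw_def)
  have bE: "b i \<in> E\<^sup>\<bottom>" if "i \<notin> K" for i
    using bB[OF that] B span_superset by (auto simp: orthonormal_basis_of_def)
  have vE: "v i \<in> E" if "i \<in> K" for i
    using that E span_superset[of "v ` K"] by (auto simp: orthonormal_basis_of_def)
  have vE': "v i \<in> (E\<^sup>\<bottom>)\<^sup>\<bottom>" if "i \<in> K" for i
    using vE[OF that] orthogonal_comp_subset by blast
  have ov: "v i \<bullet> v l = of_bool (i = l)" if "i \<in> K" "l \<in> K" for i l
    using E that inj by (auto simp: orthonormal_basis_of_def pairwise_def orthogonal_def inj_on_def dot_square_norm)
  have ob: "b i \<bullet> b l = of_bool (i = l)" if "i \<notin> K" "l \<notin> K" for i l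
  proof (cases "i = l")
    case False
    then have "b i \<noteq> b l" using b that by (auto simp: bij_betw_def dest: inj_onD)
    then show ?thesis
      using B bB that False by (auto simp: orthonormal_basis_of_def pairwise_def orthogonal_def)
  qed (use B bB that in \<open>auto simp: orthonormal_basis_of_def dot_square_norm\<close>)
  have vb: "v i \<bullet> b l = 0" "b l \<bullet> v i = 0" if "i \<in> K" "l \<notin> K" for i l
    using vE[OF that(1)] bE[OF that(2)] by (auto simp: orthogonal_comp_def orthogonal_def inner_commute)
  have ow: "w i \<bullet> w l = of_bool (i = l)" for i l
    using ov ob vb by (auto simp: w_def)
  have det_w: "\<bar>det (\<chi> r i. w i $ r)\<bar> = 1" using abs_det_orthonormal_columns[OF ow] .
  then have det_w_nonzero: "det (\<chi> r i. w i $ r) \<noteq> 0" by auto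
  have wK: "w i = v i" if "i \<in> K" for i using that by (simp add: w_def)
  have "ennreal \<bar>det (\<chi> r i. v i $ r)\<bar>
      * (\<integral>\<^sup>+c. h (\<Sum>i\<in>-K. c i *\<^sub>R orth_proj (E\<^sup>\<bottom>) (v i)) \<partial>lborel_PiM (-K))
    = (\<integral>\<^sup>+x. h (orth_proj (E\<^sup>\<bottom>) x) * (\<Prod>l\<in>K. indicator {0..1} (x \<bullet> v l)) \<partial>lborel)"
    using nn_integral_orth_proj_unit_cube[OF V h, of K v] vE' ov det by simp
  also have "\<dots> = (\<integral>\<^sup>+x. h (orth_proj (E\<^sup>\<bottom>) x) * (\<Prod>l\<in>K. indicator {0..1} (x \<bullet> w l)) \<partial>lborel)"
    by (simp add: wK cong: prod.cong)
  also have "\<dots> = (\<integral>\<^sup>+c. h (\<Sum>i\<in>-K. c i *\<^sub>R orth_proj (E\<^sup>\<bottom>) (w i)) \<partial>lborel_PiM (-K))"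
    using nn_integral_orth_proj_unit_cube[OF V h, of K w] vE' wK ov det_w det_w_nonzero by simp
  also have "\<dots> = (\<integral>\<^sup>+c. h (\<Sum>i\<in>-K. c i *\<^sub>R b i) \<partial>lborel_PiM (-K))"
  proof -
    have "orth_proj (E\<^sup>\<bottom>) (w i) = b i" if "i \<in> -K" for i
      using that orth_proj_ident[OF V bE, of i] by (simp add: w_def)
    then have "(\<Sum>i\<in>-K. c i *\<^sub>R orth_proj (E\<^sup>\<bottom>) (w i)) = (\<Sum>i\<in>-K. c i *\<^sub>R b i)" for c
      by (intro sum.cong) simp_all
    then show ?thesis by simp
  qed
  also have "\<dots> = (\<integral>\<^sup>+y. h y \<partial>subspace_lborel (E\<^sup>\<bottom>))"
    using int[OF b] by simp
  finally show ?thesis by simp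
qed

text \<open>
  Change \<open>f\<close> to \<open>\<infinity>\<close> on a Borel null set outside which it agrees with a Borel function.
\<close>

lemma completion_borel_majorant:
  fixes f :: "'a \<Rightarrow> ennreal"
  assumes "f \<in> borel_measurable (completion M)"
  obtains g where "g \<in> borel_measurable M" "\<And>x. x \<in> space M \<Longrightarrow> f x \<le> g x"
    "(\<integral>\<^sup>+x. g x \<partial>M) = (\<integral>\<^sup>+x. f x \<partial>completion M)"
proof -
  obtain g0 where [measurable]: "g0 \<in> borel_measurable M" and ae: "AE x in M. f x = g0 x"
    using completion_ex_borel_measurable[OF assms] by blast
  obtain N where N: "N \<in> null_sets M" "{x \<in> space M. f x \<noteq> g0 x} \<subseteq> N"
    using ae by (auto simp: eventually_ae_filter)
  have [measurable]: "N \<in> sets M" using N(1) by auto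
  define g where "g x = (if x \<in> N then \<infinity> else g0 x)" for x
  show ?thesis
  proof
    show "g \<in> borel_measurable M" unfolding g_def by measurable
    show "f x \<le> g x" if "x \<in> space M" for x using N(2) that by (auto simp: g_def)
    have "AE x in M. g x = f x"
      using ae AE_not_in[OF N(1)] by eventually_elim (simp add: g_def)
    then show "(\<integral>\<^sup>+x. g x \<partial>M) = (\<integral>\<^sup>+x. f x \<partial>completion M)"
      unfolding nn_integral_completion by (rule nn_integral_cong_AE)
  qed
qed

section \<open>The inequality for subspaces in direct sum\<close>

lemma block_orthonormal_det_nonzero:
  fixes A :: "real^'n^'n"
  assumes "internal_direct_sum J E" "block_orthonormal J E A"
  shows "det A \<noteq> 0"
proof -
  obtain \<beta> where \<beta>: "\<And>j. j \<in> J \<Longrightarrow> orthonormal_basis_of (E j) ((\<lambda>i. column i A) ` {i. \<beta> i = j})"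
    using assms(2) unfolding block_orthonormal_def by blast
  have "E j \<subseteq> span (columns A)" if "j \<in> J" for j
  proof -
    have "span ((\<lambda>i. column i A) ` {i. \<beta> i = j}) \<subseteq> span (columns A)"
      by (rule span_mono) (auto simp: columns_def)
    then show ?thesis using \<beta>[OF that] by (simp add: orthonormal_basis_of_def)
  qed
  then have "x \<in> span (columns A)" for x
    using assms(1) unfolding internal_direct_sum_def by (metis (no_types, lifting) PiE_mem span_sum subsetD)
  then have "span (columns A) = UNIV" by blast
  then have "invertible A"
    by (simp add: invertible_right_inverse matrix_right_invertible_span_columns span_vec_eq)
  then show ?thesis by (simp add: invertible_det_nz)
qed

theorem proposition9p1:
  fixes d :: nat
    and E :: "nat \<Rightarrow> (real^'n) set"
    and k :: "nat \<Rightarrow> nat"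
    and f :: "nat \<Rightarrow> real^'n \<Rightarrow> ennreal"
  assumes "d \<ge> 2"
    and "\<And>j. j \<in> {1..d} \<Longrightarrow> subspace (E j)"
    and "\<And>j. j \<in> {1..d} \<Longrightarrow> dim (E j) = k j"
    and "(\<Sum>j=1..d. k j) = CARD('n)"
    and "internal_direct_sum {1..d} E"
    and "\<And>j. j \<in> {1..d} \<Longrightarrow> f j \<in> borel_measurable (subspace_lebesgue ((E j)\<^sup>\<bottom>))"
  shows "(\<integral>\<^sup>+ x. (\<Prod>j=1..d. ennreal_powr (f j (orth_proj ((E j)\<^sup>\<bottom>) x)) (1 / (real d - 1))) \<partial>lebesgue)
    \<le> ennreal (wedge {1..d} E powr (- 1 / (real d - 1)))
      * (\<Prod>j=1..d. ennreal_powr (\<integral>\<^sup>+ y. f j y \<partial>subspace_lebesgue ((E j)\<^sup>\<bottom>)) (1 / (real d - 1)))"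
proof -
  define p where "p = 1 / (real d - 1)"
  have p: "p > 0" and dp: "(real d - 1) * p = 1" using assms(1) by (auto simp: p_def)
  have "\<exists>A. block_orthonormal {1..d} E A"
    using assms(2-4) by (intro block_orthonormal_exists) auto
  then obtain A where A: "block_orthonormal {1..d} E A" by blast
  obtain \<beta> where \<beta>: "\<And>i. \<beta> i \<in> {1..d}"
    "\<And>j. j \<in> {1..d} \<Longrightarrow> inj_on (\<lambda>i. column i A) {i. \<beta> i = j}"
    "\<And>j. j \<in> {1..d} \<Longrightarrow> orthonormal_basis_of (E j) ((\<lambda>i. column i A) ` {i. \<beta> i = j})"
    using A unfolding block_orthonormal_def by blast
  have A_cols: "(\<chi> r i. column i A $ r) = A" by (simp add: vec_eq_iff column_def)
  have det: "det A \<noteq> 0" using block_orthonormal_det_nonzero[OF assms(5) A] .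
  define w where "w = \<bar>det A\<bar>"
  have w: "w > 0" "wedge {1..d} E = w" using det wedge_eq[OF A] by (auto simp: w_def)
  define P where "P j = orth_proj ((E j)\<^sup>\<bottom>)" for j
  have subsp: "subspace ((E j)\<^sup>\<bottom>)" for j by (rule subspace_orthogonal_comp)
  define S where "S j = - {i. \<beta> i = j}" for j

  have "\<exists>g. g \<in> borel_measurable (restrict_space borel ((E j)\<^sup>\<bottom>)) \<and> (\<forall>y\<in>(E j)\<^sup>\<bottom>. f j y \<le> g y)
      \<and> (\<integral>\<^sup>+y. g y \<partial>subspace_lborel ((E j)\<^sup>\<bottom>)) = (\<integral>\<^sup>+y. f j y \<partial>subspace_lebesgue ((E j)\<^sup>\<bottom>))"
    if "j \<in> {1..d}" for j
  proof -
    have sp: "space (subspace_lborel ((E j)\<^sup>\<bottom>)) = (E j)\<^sup>\<bottom>"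
      using sets_eq_imp_space_eq[OF sets_subspace_lborel] by (simp add: space_restrict_space)
    show ?thesis
      using completion_borel_majorant[OF assms(6)[OF that, unfolded subspace_lebesgue_def]]
      unfolding sp measurable_cong_sets[OF sets_subspace_lborel refl] subspace_lebesgue_def by metis
  qed
  then obtain g where g: "\<And>j. j \<in> {1..d} \<Longrightarrow> g j \<in> borel_measurable (restrict_space borel ((E j)\<^sup>\<bottom>))"
    "\<And>j y. j \<in> {1..d} \<Longrightarrow> y \<in> (E j)\<^sup>\<bottom> \<Longrightarrow> f j y \<le> g j y"
    "\<And>j. j \<in> {1..d} \<Longrightarrow> (\<integral>\<^sup>+y. g j y \<partial>subspace_lborel ((E j)\<^sup>\<bottom>)) = (\<integral>\<^sup>+y. f j y \<partial>subspace_lebesgue ((E j)\<^sup>\<bottom>))"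
    by metis
  have gP [measurable]: "(\<lambda>x. g j (P j x)) \<in> borel_measurable borel" if "j \<in> {1..d}" for j
    unfolding P_def using measurable_compose[OF measurable_orth_proj[OF subsp] g(1)[OF that]] .

  define G where "G j c = g j (\<Sum>i\<in>S j. c i *\<^sub>R P j (column i A))" for j and c :: "'n \<Rightarrow> real"
  have G_meas: "G j \<in> borel_measurable (lborel_PiM (S j))" if "j \<in> {1..d}" for j
  proof -
    have "(\<lambda>c. \<Sum>i\<in>S j. c i *\<^sub>R P j (column i A)) \<in> lborel_PiM (S j) \<rightarrow>\<^sub>M restrict_space borel ((E j)\<^sup>\<bottom>)"
      by (intro measurable_restrict_space2)
         (auto simp: P_def intro!: subspace_sum[OF subsp] subspace_scale[OF subsp] orth_proj_properties(1)[OF subsp])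
    from measurable_compose[OF this g(1)[OF that]] show ?thesis by (simp add: G_def[abs_def])
  qed
  \<comment> \<open>The projection \<open>P j\<close> kills the columns in block \<open>j\<close>, so only the coordinates in \<open>S j\<close> matter.\<close>
  have gG: "g j (P j (\<Sum>i\<in>UNIV. c i *\<^sub>R column i A)) = G j (restrict c (S j))" if "j \<in> {1..d}" for j c
  proof -
    have lin: "linear (P j)" unfolding P_def by (rule linear_orth_proj[OF subsp])
    have "P j (column i A) = 0" if "\<beta> i = j" for i
    proof -
      have "column i A \<in> E j"
        using \<beta>(3)[OF \<open>j \<in> {1..d}\<close>] that span_superset[of "(\<lambda>i. column i A) ` {i. \<beta> i = j}"]
        by (auto simp: orthonormal_basis_of_def)
      then show ?thesis
        unfolding P_def using orthogonal_comp_subset by (blast intro: orth_proj_orthogonal_comp[OF subsp])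
    qed
    then have "(\<Sum>i\<in>UNIV. c i *\<^sub>R P j (column i A)) = (\<Sum>i\<in>S j. c i *\<^sub>R P j (column i A))"
      by (intro sum.mono_neutral_right) (auto simp: S_def)
    then show ?thesis by (simp add: G_def linear_sum[OF lin] linear_scale[OF lin])
  qed
  have prod_gG: "(\<Prod>j=1..d. ennreal_powr (g j (P j (\<Sum>i\<in>UNIV. c i *\<^sub>R column i A))) p)
      = (\<Prod>j=1..d. ennreal_powr (G j (restrict c (S j))) p)" for c
    by (rule prod.cong) (simp_all only: gG)
  have int_G: "ennreal w * (\<integral>\<^sup>+c. G j c \<partial>lborel_PiM (S j)) = (\<integral>\<^sup>+y. f j y \<partial>subspace_lebesgue ((E j)\<^sup>\<bottom>))"
    if "j \<in> {1..d}" for j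
    using nn_integral_subspace_lborel_oblique[OF \<beta>(2)[OF that] \<beta>(3)[OF that] g(1)[OF that]] det g(3)[OF that]
    by (simp add: G_def S_def P_def A_cols w_def)

  have "(\<integral>\<^sup>+ x. (\<Prod>j=1..d. ennreal_powr (f j (P j x)) p) \<partial>lebesgue)
      \<le> (\<integral>\<^sup>+ x. (\<Prod>j=1..d. ennreal_powr (g j (P j x)) p) \<partial>lborel)"
    unfolding nn_integral_completion
    using p orth_proj_properties(1)[OF subsp]
    by (intro nn_integral_mono prod_mono_ennreal ennreal_powr_mono g(2)) (auto simp: P_def)
  also have "\<dots> = ennreal w * (\<integral>\<^sup>+c. (\<Prod>j=1..d. ennreal_powr (G j (restrict c (S j))) p) \<partial>lborel_PiM UNIV)"
    using nn_integral_lborel_columns[of "\<lambda>i. column i A" "\<lambda>x. \<Prod>j=1..d. ennreal_powr (g j (P j x)) p"] det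
    by (simp only: A_cols w_def prod_gG) measurable
  also have "\<dots> \<le> ennreal w * (\<Prod>j=1..d. ennreal_powr (\<integral>\<^sup>+c. G j c \<partial>lborel_PiM (S j)) p)"
  proof (intro mult_left_mono lborel_PiM.nn_integral_Finner)
    \<comment> \<open>Only the function belonging to the block of \<open>i\<close> does not depend on the coordinate \<open>i\<close>, so
      the exponents at \<open>i\<close> sum to \<open>(d - 1) * p = 1\<close>.\<close>
    fix i :: 'n
    have "{j. j \<in> {1..d} \<and> i \<in> S j} = {1..d} - {\<beta> i}" by (auto simp: S_def)
    then have "(\<Sum>j | j \<in> {1..d} \<and> i \<in> S j. p) = real (card ({1..d} - {\<beta> i})) * p" by simp
    also have "card ({1..d} - {\<beta> i}) = d - 1" using \<beta>(1) by simp
    finally show "(\<Sum>j | j \<in> {1..d} \<and> i \<in> S j. p) = 1" using dp assms(1) by (simp add: of_nat_diff)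
  qed (use p G_meas in auto)
  also have "\<dots> = ennreal (w powr (- p))
      * (\<Prod>j=1..d. ennreal_powr (\<integral>\<^sup>+ y. f j y \<partial>subspace_lebesgue ((E j)\<^sup>\<bottom>)) p)"
  proof -
    \<comment> \<open>Collect the powers of \<open>w\<close>: one from the change of variables and \<open>- p\<close> from each of the \<open>d\<close> integrals.\<close>
    have "w powr (- p) * (w powr p) ^ d = w powr ((real d - 1) * p)"
      using w(1) by (simp add: powr_power powr_add[symmetric] algebra_simps)
    also have "\<dots> = w" using w(1) dp by simp
    finally have w_split: "ennreal w = ennreal (w powr (- p)) * ennreal (w powr p) ^ d"
      using w(1) by (simp add: ennreal_power flip: ennreal_mult)
    have "(\<Prod>j=1..d. ennreal_powr (\<integral>\<^sup>+ y. f j y \<partial>subspace_lebesgue ((E j)\<^sup>\<bottom>)) p)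
        = (\<Prod>j=1..d. ennreal (w powr p) * ennreal_powr (\<integral>\<^sup>+c. G j c \<partial>lborel_PiM (S j)) p)"
      using w(1) by (intro prod.cong refl) (simp add: ennreal_powr_mult flip: int_G)
    then show ?thesis by (simp add: prod.distrib w_split mult.assoc)
  qed
  finally show ?thesis unfolding w(2) by (simp add: p_def P_def)
qed

end
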